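(* Let $N\ge 1$, let $\vec f_1,\dots,\vec f_N\in\mathbb{C}^N$, and let $F$ be the $N\times N$ complex matrix whose $j$th column is $\vec f_j$. Then $$|\mathrm{perm}(F)|\le \frac{N!}{N^{N/2}}\prod_{j=1}^N|\vec f_j| .$$ Moreover, for $N>2$, equality holds in this inequality if and only if either at least one of the vectors $\vec f_j$ is zero, or else $F$ is a rank one matrix and each of the vectors $\vec f_j$ is a constant modulus vector.
   Context: For $\vec f\in\mathbb{C}^N$, $|\vec f|$ denotes the Euclidean norm: $|\vec f|^2$ is the sum of the absolute squares of the entries of $\vec f$. The permanent of an $N\times N$ matrix $F=(F_{i,j})$ is $\mathrm{perm}(F)=\sum_{\sigma}\prod_{j=1}^N F_{\sigma(j),j}$, the sum being over all permutations $\sigma$ of $\{1,\dots,N\}$. A vector is a constant modulus vector if all of its entries have the same absolute value. *)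

theory Defs
  imports "HOL-Analysis.Analysis"
begin

definition permanent :: "'a::comm_semiring_1 ^ 'n ^ 'n \<Rightarrow> 'a" where
  "permanent A = (\<Sum>\<sigma> | \<sigma> permutes (UNIV :: 'n set). \<Prod>j\<in>UNIV. A $ \<sigma> j $ j)"

definition constant_modulus :: "complex ^ 'n \<Rightarrow> bool" where
  "constant_modulus v \<longleftrightarrow> (\<forall>i k. cmod (v $ i) = cmod (v $ k))"

end

theory Submission
  imports Defs
begin

text \<open>
  Expand the permanent one column at a time.  For a set \<open>J\<close> of columns, the permanents of the
  square submatrices with columns \<open>J\<close> form a function on the sets of \<open>card J\<close> rows, and Laplace
  expansion says that adding a column \<open>g\<close> applies the operator
  \<open>(raise g a) T = (\<Sum>i\<in>T. g i * a (T - {i}))\<close>, which maps functions of \<open>k\<close>-sets to functions of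
  \<open>k + 1\<close>-sets.  Its norm between the two \<open>\<ell>\<^sup>2\<close> spaces is at most
  \<open>sqrt ((k + 1) * (N - k) / N)\<close> times the norm of \<open>g\<close> (\<open>energy_raise_le\<close>), the value for a constant
  vector \<open>g\<close>.  Since the squares of these factors multiply to \<open>(N!)\<^sup>2 / N\<^sup>N\<close> over \<open>k < N\<close>, the bound
  on the permanent follows.

  The norm bound combines two estimates.  Normalise \<open>g\<close> and let \<open>w S\<close> be the sum of the
  \<open>\<bar>g i\<bar>\<^sup>2\<close> over \<open>S\<close>.  Cauchy--Schwarz on each \<open>T\<close> gives
  \<open>\<parallel>raise g a\<parallel>\<^sup>2 \<le> (k + 1) * (\<Sum>S. \<bar>a S\<bar>\<^sup>2 * (1 - w S))\<close>, which is good where \<open>w S\<close> is large.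
  Deleting one point of the ground set, using the bound for \<open>N - 1\<close> points and averaging over the
  deleted point gives
  \<open>(N - 1) * \<parallel>raise g a\<parallel>\<^sup>2 \<le> (k + 1) * (\<Sum>S. \<bar>a S\<bar>\<^sup>2 * (N - k - 1 + w S))\<close>, which is good where
  \<open>w S\<close> is small.  In the sum of the two, \<open>w\<close> cancels and exactly the claimed bound for \<open>N\<close>
  points remains.  This needs \<open>k + 1 < N\<close>; for \<open>k + 1 = N\<close> Cauchy--Schwarz alone gives the bound.

  Equality in the bound forces equality in the Cauchy--Schwarz step whenever \<open>k + 2 \<le> N\<close>.  For
  \<open>N > 2\<close> this applies to \<open>k = 1\<close>.  As the columns may be added in any order, every pair of
  columns can be put first, so if equality holds and no column is zero, any two columns are parallel
  and of constant modulus (\<open>energy_subperm_pair_eq_imp\<close>).  Conversely, for a matrix of rank one all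
  terms of the permanent are equal, and constant modulus turns their common modulus into
  the product of the norms divided by \<open>N\<close> to the power \<open>N / 2\<close>.
\<close>

section \<open>Cauchy--Schwarz with its defect\<close>

lemma card_sum_norm_sq_minus_norm_sum_sq:
  fixes z :: "'i \<Rightarrow> 'a::real_inner"
  shows "real (card T) * (\<Sum>i\<in>T. (norm (z i))\<^sup>2) - (norm (\<Sum>i\<in>T. z i))\<^sup>2
           = (\<Sum>i\<in>T. \<Sum>j\<in>T. (norm (z i - z j))\<^sup>2) / 2"
proof -
  have "(\<Sum>i\<in>T. \<Sum>j\<in>T. (norm (z i - z j))\<^sup>2)
      = (\<Sum>i\<in>T. \<Sum>j\<in>T. (norm (z i))\<^sup>2 + (norm (z j))\<^sup>2 - 2 * (z i \<bullet> z j))"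
    by (intro sum.cong refl)
       (simp add: power2_norm_eq_inner inner_diff_left inner_diff_right inner_commute)
  also have "\<dots> = 2 * (real (card T) * (\<Sum>i\<in>T. (norm (z i))\<^sup>2)) - 2 * (\<Sum>i\<in>T. \<Sum>j\<in>T. z i \<bullet> z j)"
    by (simp add: sum.distrib sum_subtractf sum_distrib_left)
  also have "(\<Sum>i\<in>T. \<Sum>j\<in>T. z i \<bullet> z j) = (norm (\<Sum>i\<in>T. z i))\<^sup>2"
    by (simp add: power2_norm_eq_inner inner_sum_left inner_sum_right) (rule sum.swap)
  finally show ?thesis by simp
qed

lemma norm_sum_sq_le:
  fixes z :: "'i \<Rightarrow> 'a::real_inner"
  shows "(norm (\<Sum>i\<in>T. z i))\<^sup>2 \<le> real (card T) * (\<Sum>i\<in>T. (norm (z i))\<^sup>2)"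
proof -
  have "0 \<le> (\<Sum>i\<in>T. \<Sum>j\<in>T. (norm (z i - z j))\<^sup>2) / 2"
    by (intro divide_nonneg_pos sum_nonneg) auto
  then show ?thesis
    using card_sum_norm_sq_minus_norm_sum_sq[of T z] by linarith
qed

lemma norm_sum_sq_eq_imp_constant:
  fixes z :: "'i \<Rightarrow> 'a::real_inner"
  assumes "finite T"
    and eq: "(norm (\<Sum>i\<in>T. z i))\<^sup>2 = real (card T) * (\<Sum>i\<in>T. (norm (z i))\<^sup>2)"
    and "i \<in> T" "j \<in> T"
  shows "z i = z j"
proof -
  have "(\<Sum>i\<in>T. \<Sum>j\<in>T. (norm (z i - z j))\<^sup>2) = 0"
    using card_sum_norm_sq_minus_norm_sum_sq[of T z] eq by linarith
  then have "\<forall>i\<in>T. (\<Sum>j\<in>T. (norm (z i - z j))\<^sup>2) = 0"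
    using \<open>finite T\<close> by (subst (asm) sum_nonneg_eq_0_iff) (auto intro: sum_nonneg)
  then have "(\<Sum>j\<in>T. (norm (z i - z j))\<^sup>2) = 0"
    using \<open>i \<in> T\<close> by blast
  then have "(norm (z i - z j))\<^sup>2 = 0"
    using \<open>finite T\<close> \<open>j \<in> T\<close> by (subst (asm) sum_nonneg_eq_0_iff) auto
  then show ?thesis by simp
qed

section \<open>The raising operator on functions of k-element sets\<close>

definition layer :: "'i set \<Rightarrow> nat \<Rightarrow> 'i set set" where
  "layer V k = {S. S \<subseteq> V \<and> card S = k}"

definition energy :: "'i set \<Rightarrow> nat \<Rightarrow> ('i set \<Rightarrow> complex) \<Rightarrow> real" where
  "energy V k a = (\<Sum>S\<in>layer V k. (cmod (a S))\<^sup>2)"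

definition raise :: "('i \<Rightarrow> complex) \<Rightarrow> ('i set \<Rightarrow> complex) \<Rightarrow> 'i set \<Rightarrow> complex" where
  "raise g a T = (\<Sum>i\<in>T. g i * a (T - {i}))"

lemma finite_layer: "finite V \<Longrightarrow> finite (layer V k)"
  by (simp add: layer_def)

lemma layer_card: "finite V \<Longrightarrow> layer V (card V) = {V}"
  by (auto simp: layer_def dest: card_subset_eq)

lemma sum_layer_const: "(\<Sum>S\<in>layer V k. (cmod (a S))\<^sup>2 * c) = c * energy V k a"
  by (simp add: energy_def sum_distrib_left mult.commute)

lemma sum_layer_Suc:
  fixes h :: "'i \<Rightarrow> 'i set \<Rightarrow> 'b::comm_monoid_add"
  assumes "finite V"
  shows "(\<Sum>T\<in>layer V (Suc k). \<Sum>i\<in>T. h i (T - {i})) = (\<Sum>S\<in>layer V k. \<Sum>i\<in>V - S. h i S)"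
proof -
  have fin: "finite S" if "S \<subseteq> V" for S
    using that assms finite_subset by blast
  have "(\<Sum>T\<in>layer V (Suc k). \<Sum>i\<in>T. h i (T - {i}))
      = (\<Sum>(T, i)\<in>(SIGMA T:layer V (Suc k). T). h i (T - {i}))"
    by (rule sum.Sigma) (auto simp: assms finite_layer layer_def intro: fin)
  also have "\<dots> = (\<Sum>(S, i)\<in>(SIGMA S:layer V k. V - S). h i S)"
    by (rule sum.reindex_bij_witness[where i = "\<lambda>(S, i). (insert i S, i)"
          and j = "\<lambda>(T, i). (T - {i}, i)"])
       (auto simp: layer_def fin card_Diff_singleton insert_absorb)
  also have "\<dots> = (\<Sum>S\<in>layer V k. \<Sum>i\<in>V - S. h i S)"
    by (rule sum.Sigma[symmetric]) (auto simp: assms finite_layer)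
  finally show ?thesis .
qed

lemma sum_layer_remove:
  fixes h :: "'i \<Rightarrow> 'i set \<Rightarrow> 'b::comm_monoid_add"
  assumes "finite V"
  shows "(\<Sum>i\<in>V. \<Sum>S\<in>layer (V - {i}) k. h i S) = (\<Sum>S\<in>layer V k. \<Sum>i\<in>V - S. h i S)"
proof -
  have remove: "layer (V - {i}) k = {S \<in> layer V k. i \<notin> S}" for i
    by (auto simp: layer_def)
  have "(\<Sum>i\<in>V. \<Sum>S\<in>layer (V - {i}) k. h i S) = (\<Sum>i\<in>V. \<Sum>S | S \<in> layer V k \<and> i \<notin> S. h i S)"
    by (simp only: remove)
  also have "\<dots> = (\<Sum>S\<in>layer V k. \<Sum>i | i \<in> V \<and> i \<notin> S. h i S)"
    by (rule sum.swap_restrict) (use assms in \<open>auto intro: finite_layer\<close>)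
  finally show ?thesis
    by (simp only: set_diff_eq)
qed

text \<open>
  Cauchy--Schwarz over the \<open>k + 1\<close> points of each \<open>T\<close>, after which the pairs \<open>(T, i)\<close> are regrouped
  by \<open>S = T - {i}\<close>.
\<close>

lemma energy_raise_le_pointwise:
  assumes "finite V"
  shows "energy V (Suc k) (raise g a)
    \<le> real (Suc k) * (\<Sum>S\<in>layer V k. (cmod (a S))\<^sup>2 * (\<Sum>i\<in>V - S. (cmod (g i))\<^sup>2))"
proof -
  have "energy V (Suc k) (raise g a)
    \<le> (\<Sum>T\<in>layer V (Suc k). real (Suc k) * (\<Sum>i\<in>T. (cmod (g i))\<^sup>2 * (cmod (a (T - {i})))\<^sup>2))"
    unfolding energy_def
  proof (rule sum_mono)
    fix T assume "T \<in> layer V (Suc k)"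
    then have "card T = Suc k" by (simp add: layer_def)
    then show "(cmod (raise g a T))\<^sup>2
        \<le> real (Suc k) * (\<Sum>i\<in>T. (cmod (g i))\<^sup>2 * (cmod (a (T - {i})))\<^sup>2)"
      using norm_sum_sq_le[of "\<lambda>i. g i * a (T - {i})" T]
      by (simp add: raise_def norm_mult power_mult_distrib)
  qed
  also have "\<dots> = real (Suc k) * (\<Sum>S\<in>layer V k. (cmod (a S))\<^sup>2 * (\<Sum>i\<in>V - S. (cmod (g i))\<^sup>2))"
    by (simp only: sum_distrib_left[symmetric] sum_layer_Suc[OF assms, where h = "\<lambda>i S. (cmod (g i))\<^sup>2 * (cmod (a S))\<^sup>2"])
       (simp add: sum_distrib_left mult.commute)
  finally show ?thesis .
qed

lemma energy_raise_eq_pointwise_imp: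
  assumes "finite V"
    and eq: "energy V (Suc k) (raise g a)
      = real (Suc k) * (\<Sum>S\<in>layer V k. (cmod (a S))\<^sup>2 * (\<Sum>i\<in>V - S. (cmod (g i))\<^sup>2))"
    and T: "T \<in> layer V (Suc k)" "i \<in> T" "j \<in> T"
  shows "g i * a (T - {i}) = g j * a (T - {j})"
proof -
  let ?z = "\<lambda>T i. g i * a (T - {i})"
  let ?d = "\<lambda>T. real (Suc k) * (\<Sum>i\<in>T. (cmod (?z T i))\<^sup>2) - (cmod (raise g a T))\<^sup>2"
  have "(\<Sum>T\<in>layer V (Suc k). ?d T) = 0"
    unfolding sum_subtractf sum_distrib_left[symmetric]
    using eq sum_layer_Suc[OF \<open>finite V\<close>, where h = "\<lambda>i S. (cmod (g i))\<^sup>2 * (cmod (a S))\<^sup>2" and k = k]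
    by (simp add: energy_def norm_mult power_mult_distrib sum_distrib_left mult.commute)
  moreover have "0 \<le> ?d T" if "T \<in> layer V (Suc k)" for T
  proof -
    have "card T = Suc k" using that by (simp add: layer_def)
    then show ?thesis
      using norm_sum_sq_le[of "?z T" T] by (simp add: raise_def)
  qed
  ultimately have "?d T = 0"
    using T(1) finite_layer[OF \<open>finite V\<close>] by (subst (asm) sum_nonneg_eq_0_iff) auto
  moreover have "card T = Suc k" "finite T"
    using T(1) by (auto simp: layer_def intro: card_ge_0_finite)
  ultimately show ?thesis
    using norm_sum_sq_eq_imp_constant[of T "?z T" i j] T by (simp add: raise_def)
qed

text \<open>
  Both sides of the hypotheses are summed over the deleted point.  Each \<open>T\<close> survives
  \<open>card V - k - 1\<close> deletions, and the same factor sits on the right of every hypothesis; it cancels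
  because it is positive.
\<close>

lemma energy_raise_le_average:
  fixes g :: "'i \<Rightarrow> complex"
  assumes "finite V" and k: "Suc k < card V"
    and IH: "\<And>i. i \<in> V \<Longrightarrow> real (card (V - {i})) * energy (V - {i}) (Suc k) (raise g a)
        \<le> real (Suc k) * real (card (V - {i}) - k) * (\<Sum>j\<in>V - {i}. (cmod (g j))\<^sup>2) * energy (V - {i}) k a"
  shows "(real (card V) - 1) * energy V (Suc k) (raise g a)
    \<le> real (Suc k) * (\<Sum>S\<in>layer V k. (cmod (a S))\<^sup>2 *
        (real (card V - k) * (\<Sum>j\<in>V. (cmod (g j))\<^sup>2) - (\<Sum>j\<in>V - S. (cmod (g j))\<^sup>2)))"
    (is "_ \<le> _ * ?R")
proof -
  define N where "N = real (card V)"
  define m where "m = N - 1 - real k"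
  define G where "G = (\<Sum>j\<in>V. (cmod (g j))\<^sup>2)"
  have m: "0 < m" using k by (simp add: m_def N_def)
  have cV: "real (card (V - {i})) = N - 1" and cVk: "real (card (V - {i}) - k) = m" if "i \<in> V" for i
    using that k \<open>finite V\<close> by (auto simp: N_def m_def of_nat_diff)
  have "m * ((N - 1) * energy V (Suc k) (raise g a))
      = (N - 1) * (\<Sum>i\<in>V. energy (V - {i}) (Suc k) (raise g a))"
  proof -
    have "(\<Sum>i\<in>V. energy (V - {i}) (Suc k) (raise g a))
        = (\<Sum>T\<in>layer V (Suc k). \<Sum>i\<in>V - T. (cmod (raise g a T))\<^sup>2)"
      unfolding energy_def by (rule sum_layer_remove[OF \<open>finite V\<close>])
    also have "\<dots> = (\<Sum>T\<in>layer V (Suc k). m * (cmod (raise g a T))\<^sup>2)"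
    proof (intro sum.cong refl)
      fix T assume "T \<in> layer V (Suc k)"
      then have "real (card (V - T)) = m"
        using k \<open>finite V\<close> by (auto simp: layer_def card_Diff_subset finite_subset m_def N_def of_nat_diff)
      then show "(\<Sum>i\<in>V - T. (cmod (raise g a T))\<^sup>2) = m * (cmod (raise g a T))\<^sup>2"
        by simp
    qed
    finally show ?thesis by (simp add: energy_def sum_distrib_left mult_ac)
  qed
  also have "\<dots> \<le> (\<Sum>i\<in>V. real (Suc k) * m * (G - (cmod (g i))\<^sup>2) * energy (V - {i}) k a)"
    unfolding sum_distrib_left
  proof (rule sum_mono)
    fix i assume i: "i \<in> V"
    then have "(\<Sum>j\<in>V - {i}. (cmod (g j))\<^sup>2) = G - (cmod (g i))\<^sup>2"
      using \<open>finite V\<close> by (simp add: G_def sum_diff1)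
    then show "(N - 1) * energy (V - {i}) (Suc k) (raise g a)
        \<le> real (Suc k) * m * (G - (cmod (g i))\<^sup>2) * energy (V - {i}) k a"
      using IH[OF i] cV[OF i] cVk[OF i] by simp
  qed
  also have "\<dots> = m * (real (Suc k) * (\<Sum>i\<in>V. \<Sum>S\<in>layer (V - {i}) k. (G - (cmod (g i))\<^sup>2) * (cmod (a S))\<^sup>2))"
    by (simp add: energy_def sum_distrib_left mult_ac)
  also have "(\<Sum>i\<in>V. \<Sum>S\<in>layer (V - {i}) k. (G - (cmod (g i))\<^sup>2) * (cmod (a S))\<^sup>2) = ?R"
    unfolding sum_layer_remove[OF \<open>finite V\<close>]
  proof (intro sum.cong refl)
    fix S assume "S \<in> layer V k"
    then have "card (V - S) = card V - k"
      using \<open>finite V\<close> by (auto simp: layer_def card_Diff_subset finite_subset)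
    then show "(\<Sum>i\<in>V - S. (G - (cmod (g i))\<^sup>2) * (cmod (a S))\<^sup>2) = (cmod (a S))\<^sup>2 *
        (real (card V - k) * (\<Sum>j\<in>V. (cmod (g j))\<^sup>2) - (\<Sum>j\<in>V - S. (cmod (g j))\<^sup>2))"
      by (simp add: sum_distrib_right[symmetric] sum_subtractf G_def)
  qed
  finally show ?thesis
    using m by (simp add: N_def)
qed

text \<open>
  When \<open>k + 1\<close> exhausts the ground set, no positive factor is left to cancel in the averaging
  argument; but then there is a single \<open>T\<close> and the bound is the Cauchy--Schwarz inequality.
\<close>

lemma energy_raise_le_top:
  assumes "finite V" and "card V = Suc k"
  shows "energy V (Suc k) (raise g a) \<le> (\<Sum>i\<in>V. (cmod (g i))\<^sup>2) * energy V k a"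
proof -
  have top: "layer V (Suc k) = {V}"
    using assms layer_card by metis
  have "energy V k a = (\<Sum>S\<in>layer V k. \<Sum>i\<in>V - S. (cmod (a S))\<^sup>2)"
    unfolding energy_def
    using assms by (intro sum.cong refl) (auto simp: layer_def card_Diff_subset finite_subset)
  also have "\<dots> = (\<Sum>i\<in>V. (cmod (a (V - {i})))\<^sup>2)"
    using sum_layer_Suc[OF \<open>finite V\<close>, where h = "\<lambda>i S. (cmod (a S))\<^sup>2" and k = k] by (simp add: top)
  finally have E: "energy V k a = (\<Sum>i\<in>V. (cmod (a (V - {i})))\<^sup>2)" .
  have "cmod (raise g a V) \<le> (\<Sum>i\<in>V. cmod (g i) * cmod (a (V - {i})))"
    unfolding raise_def by (rule sum_norm_le) (simp add: norm_mult)
  then have "(cmod (raise g a V))\<^sup>2 \<le> (\<Sum>i\<in>V. cmod (g i) * cmod (a (V - {i})))\<^sup>2"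
    by (simp add: power_mono)
  also have "\<dots> \<le> (\<Sum>i\<in>V. (cmod (g i))\<^sup>2) * (\<Sum>i\<in>V. (cmod (a (V - {i})))\<^sup>2)"
    by (rule Cauchy_Schwarz_ineq_sum)
  finally show ?thesis
    unfolding E by (simp add: energy_def top)
qed

theorem energy_raise_le:
  assumes "finite V" and "k < card V"
  shows "real (card V) * energy V (Suc k) (raise g a)
    \<le> real (Suc k) * real (card V - k) * (\<Sum>i\<in>V. (cmod (g i))\<^sup>2) * energy V k a"
  using assms
proof (induction "card V" arbitrary: V)
  case 0
  then show ?case by simp
next
  case (Suc n)
  show ?case
  proof (cases "Suc k = card V")
    case True
    then show ?thesis
      using mult_left_mono[OF energy_raise_le_top[OF Suc.prems(1) True[symmetric]], of "real (Suc k)"]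
      by (simp add: True[symmetric] mult.assoc)
  next
    case False
    let ?G = "\<Sum>i\<in>V. (cmod (g i))\<^sup>2"
    have k: "Suc k < card V" using False Suc.prems by simp
    have "(real (card V) - 1) * energy V (Suc k) (raise g a)
      \<le> real (Suc k) * (\<Sum>S\<in>layer V k. (cmod (a S))\<^sup>2 *
          (real (card V - k) * ?G - (\<Sum>j\<in>V - S. (cmod (g j))\<^sup>2)))"
      by (intro energy_raise_le_average Suc.hyps(1)) (use Suc.hyps(2) Suc.prems k in auto)
    moreover have "energy V (Suc k) (raise g a)
      \<le> real (Suc k) * (\<Sum>S\<in>layer V k. (cmod (a S))\<^sup>2 * (\<Sum>i\<in>V - S. (cmod (g i))\<^sup>2))"
      by (rule energy_raise_le_pointwise[OF Suc.prems(1)])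
    (* Adding the two estimates makes the weights of the complements of the S cancel. *)
    ultimately have "real (card V) * energy V (Suc k) (raise g a)
      \<le> real (Suc k) * (\<Sum>S\<in>layer V k. (cmod (a S))\<^sup>2 * (real (card V - k) * ?G))"
      by (simp add: right_diff_distrib left_diff_distrib sum_subtractf del: of_nat_Suc)
    then show ?thesis
      by (simp add: sum_layer_const mult.assoc del: of_nat_Suc)
  qed
qed

text \<open>
  The sharp bound is the sum of the averaged and the pointwise estimate, so both are attained if
  it is.
\<close>

lemma energy_raise_eq_imp_pointwise:
  assumes "finite V" and k: "Suc k < card V"
    and eq: "real (card V) * energy V (Suc k) (raise g a)
      = real (Suc k) * real (card V - k) * (\<Sum>i\<in>V. (cmod (g i))\<^sup>2) * energy V k a"
  shows "energy V (Suc k) (raise g a)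
      = real (Suc k) * (\<Sum>S\<in>layer V k. (cmod (a S))\<^sup>2 * (\<Sum>i\<in>V - S. (cmod (g i))\<^sup>2))"
proof -
  let ?G = "\<Sum>i\<in>V. (cmod (g i))\<^sup>2"
  have "(real (card V) - 1) * energy V (Suc k) (raise g a)
    \<le> real (Suc k) * (\<Sum>S\<in>layer V k. (cmod (a S))\<^sup>2 *
        (real (card V - k) * ?G - (\<Sum>j\<in>V - S. (cmod (g j))\<^sup>2)))"
    using assms by (intro energy_raise_le_average energy_raise_le) auto
  moreover have "real (card V) * energy V (Suc k) (raise g a)
      = real (Suc k) * (\<Sum>S\<in>layer V k. (cmod (a S))\<^sup>2 * (real (card V - k) * ?G))"
    using eq by (simp add: sum_layer_const mult.assoc del: of_nat_Suc)
  moreover note energy_raise_le_pointwise[OF \<open>finite V\<close>, of k g a]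
  ultimately show ?thesis
    by (simp add: right_diff_distrib left_diff_distrib sum_subtractf del: of_nat_Suc)
qed

section \<open>Permanents of square submatrices\<close>

text \<open>
  The permanent of the submatrix with columns \<open>J\<close> and rows \<open>T\<close>, as a sum over the bijections from
  \<open>J\<close> to \<open>T\<close>; extensionality represents each bijection by a single function.
\<close>

definition subperm :: "('j \<Rightarrow> 'i \<Rightarrow> complex) \<Rightarrow> 'j set \<Rightarrow> 'i set \<Rightarrow> complex" where
  "subperm f J T = (\<Sum>\<sigma> | \<sigma> \<in> J \<rightarrow>\<^sub>E T \<and> bij_betw \<sigma> J T. \<Prod>j\<in>J. f j (\<sigma> j))"

lemma subperm_empty [simp]: "subperm f {} {} = 1"
proof -
  have "{\<sigma>. \<sigma> \<in> {} \<rightarrow>\<^sub>E {} \<and> bij_betw \<sigma> {} {}} = {\<lambda>x::'a. undefined :: 'b}"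
    by (auto simp: bij_betw_def)
  then show ?thesis by (simp add: subperm_def)
qed

text \<open>
  Laplace expansion along the column \<open>j\<close>: a bijection from \<open>insert j J\<close> amounts to the image \<open>i\<close> of
  \<open>j\<close> and a bijection from \<open>J\<close> to \<open>T - {i}\<close>.
\<close>

lemma subperm_insert:
  assumes "finite J" "finite T" "j \<notin> J"
  shows "subperm f (insert j J) T = raise (f j) (subperm f J) T"
proof -
  let ?B = "\<lambda>J T. {\<sigma>. \<sigma> \<in> J \<rightarrow>\<^sub>E T \<and> bij_betw \<sigma> J T}"
  have fin: "finite (?B J S)" if "finite S" for S
    using assms that by (intro finite_subset[OF _ finite_PiE[of J "\<lambda>_. S"]]) auto
  have "raise (f j) (subperm f J) T
      = (\<Sum>i\<in>T. \<Sum>\<sigma>\<in>?B J (T - {i}). f j i * (\<Prod>l\<in>J. f l (\<sigma> l)))"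
    by (simp add: raise_def subperm_def sum_distrib_left)
  also have "\<dots> = (\<Sum>(i, \<sigma>)\<in>(SIGMA i:T. ?B J (T - {i})). f j i * (\<Prod>l\<in>J. f l (\<sigma> l)))"
    by (rule sum.Sigma) (use assms fin in auto)
  also have "\<dots> = (\<Sum>\<sigma>\<in>?B (insert j J) T. \<Prod>l\<in>insert j J. f l (\<sigma> l))"
  proof (rule sum.reindex_bij_witness[where i = "\<lambda>\<sigma>. (\<sigma> j, \<sigma>(j := undefined))"
          and j = "\<lambda>(i, \<sigma>). \<sigma>(j := i)"])
    fix p assume p: "p \<in> (SIGMA i:T. ?B J (T - {i}))"
    obtain i \<sigma> where [simp]: "p = (i, \<sigma>)" by (cases p)
    have i: "i \<in> T" and \<sigma>: "\<sigma> \<in> J \<rightarrow>\<^sub>E T - {i}" "bij_betw \<sigma> J (T - {i})"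
      using p by auto
    have "\<sigma> j = undefined" using \<sigma>(1) assms(3) by (auto simp: PiE_def extensional_def)
    then show "(\<lambda>\<sigma>. (\<sigma> j, \<sigma>(j := undefined))) (case p of (i, \<sigma>) \<Rightarrow> \<sigma>(j := i)) = p"
      by auto
    have "bij_betw (\<sigma>(j := i)) J (T - {i})"
      using \<sigma>(2) assms(3) by (subst bij_betw_cong[of J _ \<sigma>]) auto
    then have "bij_betw (\<sigma>(j := i)) (J \<union> {j}) ((T - {i}) \<union> {i})"
      using assms(3) notIn_Un_bij_betw[of j J "\<sigma>(j := i)" "T - {i}"] by simp
    moreover have "(T - {i}) \<union> {i} = T" "J \<union> {j} = insert j J" using i by auto
    ultimately have "bij_betw (\<sigma>(j := i)) (insert j J) T" by metis
    moreover have "\<sigma>(j := i) \<in> insert j J \<rightarrow>\<^sub>E T"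
      using \<sigma>(1) i by (auto simp: PiE_def extensional_def Pi_def)
    ultimately show "(case p of (i, \<sigma>) \<Rightarrow> \<sigma>(j := i)) \<in> ?B (insert j J) T"
      by simp
    have "(\<Prod>l\<in>J. f l ((\<sigma>(j := i)) l)) = (\<Prod>l\<in>J. f l (\<sigma> l))"
      using assms(3) by (intro prod.cong) auto
    then show "(\<Prod>l\<in>insert j J. f l ((case p of (i, \<sigma>) \<Rightarrow> \<sigma>(j := i)) l))
        = (case p of (i, \<sigma>) \<Rightarrow> f j i * (\<Prod>l\<in>J. f l (\<sigma> l)))"
      using assms(1,3) by simp
  next
    fix \<sigma> assume "\<sigma> \<in> ?B (insert j J) T"
    then have \<sigma>: "\<sigma> \<in> insert j J \<rightarrow>\<^sub>E T" "bij_betw \<sigma> (insert j J) T" by auto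
    show "(case (\<sigma> j, \<sigma>(j := undefined)) of (i, \<sigma>) \<Rightarrow> \<sigma>(j := i)) = \<sigma>"
      by simp
    have "bij_betw \<sigma> (insert j J - {j}) (T - {\<sigma> j})"
      using \<sigma>(2) by (intro bij_betw_subset[OF \<sigma>(2), of "insert j J - {j}" "T - {\<sigma> j}"])
        (auto simp: bij_betw_def inj_on_def)
    then have "bij_betw \<sigma> J (T - {\<sigma> j})" using assms(3) by simp
    then have b: "bij_betw (\<sigma>(j := undefined)) J (T - {\<sigma> j})"
      using assms(3) by (subst bij_betw_cong[of J _ \<sigma>]) auto
    moreover have "\<sigma>(j := undefined) \<in> J \<rightarrow>\<^sub>E (T - {\<sigma> j})"
      using \<sigma>(1) bij_betwE[OF b] by (auto simp: PiE_def extensional_def Pi_def)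
    moreover have "\<sigma> j \<in> T" using \<sigma>(1) by auto
    ultimately show "(\<sigma> j, \<sigma>(j := undefined)) \<in> (SIGMA i:T. ?B J (T - {i}))"
      by auto
  qed
  finally show ?thesis by (simp add: subperm_def)
qed

lemma permanent_eq_subperm:
  fixes F :: "complex ^ 'n ^ 'n"
  shows "permanent F = subperm (\<lambda>j i. F $ i $ j) UNIV UNIV"
proof -
  have "\<sigma> permutes UNIV \<longleftrightarrow> bij \<sigma>" for \<sigma> :: "'n \<Rightarrow> 'n"
    using bij_imp_permutes[of \<sigma> UNIV] permutes_bij[of \<sigma> UNIV] by blast
  then show ?thesis by (simp add: permanent_def subperm_def)
qed

text \<open>
  The largest factor by which adding a unit column to \<open>k\<close> columns can increase the energy.
\<close>

definition ratio :: "nat \<Rightarrow> nat \<Rightarrow> real" where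
  "ratio N k = real (Suc k) * real (N - k) / real N"

text \<open>
  Starting from a nonempty \<open>J\<close> is what the equality case requires: a loss incurred while the first
  columns are added cannot be recovered later.
\<close>

lemma energy_subperm_Un_le:
  fixes f :: "'j \<Rightarrow> 'i::finite \<Rightarrow> complex"
  assumes "finite K" "finite J" "J \<inter> K = {}" "card J + card K \<le> CARD('i)"
  shows "energy UNIV (card J + card K) (subperm f (J \<union> K))
    \<le> (\<Prod>k\<in>{card J..<card J + card K}. ratio CARD('i) k)
        * (\<Prod>j\<in>K. \<Sum>i\<in>UNIV. (cmod (f j i))\<^sup>2) * energy UNIV (card J) (subperm f J)"
  using assms
proof (induction K rule: finite_induct)
  case empty
  then show ?case by simp
next
  case (insert j K)
  let ?k = "card J + card K"
  let ?G = "\<lambda>j. \<Sum>i\<in>UNIV. (cmod (f j i))\<^sup>2"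
  let ?c = "ratio CARD('i)"
  have "subperm f (J \<union> insert j K) = raise (f j) (subperm f (J \<union> K))"
    using insert by (intro ext) (simp add: subperm_insert)
  then have "energy UNIV (Suc ?k) (subperm f (J \<union> insert j K))
      \<le> ?c ?k * ?G j * energy UNIV ?k (subperm f (J \<union> K))"
    using energy_raise_le[of "UNIV :: 'i set" ?k "f j" "subperm f (J \<union> K)"] insert
    by (simp add: ratio_def field_simps)
  also have "\<dots> \<le> ?c ?k * ?G j * ((\<Prod>k\<in>{card J..<?k}. ?c k) * (\<Prod>j\<in>K. ?G j) * energy UNIV (card J) (subperm f J))"
    using insert by (intro mult_left_mono mult_nonneg_nonneg sum_nonneg) (auto simp: ratio_def)
  finally show ?case
    using insert by (simp add: mult_ac)
qed

lemma subperm_singleton: "subperm f {j} {i} = f j i"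
  by (simp add: subperm_insert raise_def)

lemma sum_layer_one:
  fixes h :: "'i set \<Rightarrow> 'b::comm_monoid_add"
  shows "(\<Sum>S\<in>layer V (Suc 0). h S) = (\<Sum>i\<in>V. h {i})"
proof -
  have "layer V (Suc 0) = (\<lambda>i. {i}) ` V"
    by (auto simp: layer_def card_1_singleton_iff)
  then show ?thesis by (simp add: sum.reindex)
qed

lemma energy_subperm_singleton: "energy V (Suc 0) (subperm f {j}) = (\<Sum>i\<in>V. (cmod (f j i))\<^sup>2)"
  by (simp add: energy_def sum_layer_one subperm_singleton)

lemma energy_subperm_empty: "energy UNIV 0 (subperm f {} :: 'i::finite set \<Rightarrow> complex) = 1"
proof -
  have "layer (UNIV :: 'i set) 0 = {{}}" by (auto simp: layer_def)
  then show ?thesis by (simp add: energy_def)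
qed

lemma energy_subperm_pair_le:
  fixes f :: "'j \<Rightarrow> 'i::finite \<Rightarrow> complex"
  assumes "j \<noteq> l" "2 \<le> CARD('i)"
  shows "real CARD('i) * energy UNIV 2 (subperm f {j, l})
    \<le> 2 * (real CARD('i) - 1) * (\<Sum>i\<in>UNIV. (cmod (f j i))\<^sup>2) * (\<Sum>i\<in>UNIV. (cmod (f l i))\<^sup>2)"
proof -
  have "subperm f {j, l} = raise (f j) (subperm f {l})"
    using assms by (intro ext subperm_insert) auto
  then show ?thesis
    using energy_raise_le[of "UNIV :: 'i set" "Suc 0" "f j" "subperm f {l}"] assms
    by (simp add: energy_subperm_singleton numeral_2_eq_2 of_nat_diff)
qed

text \<open>
  Let \<open>x\<close> and \<open>y\<close> be the moduli of the two columns.  Tightness of Cauchy--Schwarz on the two-point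
  sets says that all \<open>2 \<times> 2\<close> minors vanish; comparing the two expressions for the energy gives
  \<open>N * (\<Sum>i. (x i * y i)\<^sup>2) = (\<Sum>i. (x i)\<^sup>2) * (\<Sum>i. (y i)\<^sup>2)\<close>.  As the minors vanish, the right-hand side is
  the square of \<open>\<Sum>i. x i * y i\<close>, and equality in Cauchy--Schwarz makes \<open>x i * y i\<close> constant.  Since
  \<open>x\<close> and \<open>y\<close> are proportional, both are constant.
\<close>

lemma energy_subperm_pair_eq_imp:
  fixes f :: "'j \<Rightarrow> 'i::finite \<Rightarrow> complex"
  assumes "j \<noteq> l" and N: "2 < CARD('i)"
    and nz: "\<exists>i. f j i \<noteq> 0" "\<exists>i. f l i \<noteq> 0"
    and eq: "real CARD('i) * energy UNIV 2 (subperm f {j, l})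
      = 2 * (real CARD('i) - 1) * (\<Sum>i\<in>UNIV. (cmod (f j i))\<^sup>2) * (\<Sum>i\<in>UNIV. (cmod (f l i))\<^sup>2)"
  shows "f j i * f l k = f j k * f l i" and "cmod (f j i) = cmod (f j k)"
proof -
  let ?N = "real CARD('i)" and ?G = "\<lambda>j. \<Sum>i\<in>UNIV. (cmod (f j i))\<^sup>2"
  let ?x = "\<lambda>i. cmod (f j i)" and ?y = "\<lambda>i. cmod (f l i)"
  have raise: "subperm f {j, l} = raise (f j) (subperm f {l})"
    using assms by (intro ext subperm_insert) auto
  have eq': "energy UNIV (Suc (Suc 0)) (raise (f j) (subperm f {l}))
      = real (Suc (Suc 0)) * (\<Sum>S\<in>layer UNIV (Suc 0). (cmod (subperm f {l} S))\<^sup>2 * (\<Sum>i\<in>UNIV - S. (cmod (f j i))\<^sup>2))"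
    by (rule energy_raise_eq_imp_pointwise)
       (use eq N in \<open>auto simp: raise energy_subperm_singleton numeral_2_eq_2 of_nat_diff\<close>)
  have par: "f j i * f l k = f j k * f l i" for i k
  proof (cases "i = k")
    case False
    have "f j i * subperm f {l} ({i, k} - {i}) = f j k * subperm f {l} ({i, k} - {k})"
      by (rule energy_raise_eq_pointwise_imp[OF _ eq']) (use False in \<open>auto simp: layer_def\<close>)
    moreover have "{i, k} - {i} = {k}" "{i, k} - {k} = {i}" using False by auto
    ultimately show ?thesis by (simp add: subperm_singleton)
  qed simp
  then have par_cmod: "?x i * ?y k = ?x k * ?y i" for i k
    by (metis norm_mult)
  have sep: "?N * (\<Sum>i\<in>UNIV. (?x i * ?y i)\<^sup>2) = ?G j * ?G l"
  proof -
    have "energy UNIV 2 (subperm f {j, l}) = 2 * (\<Sum>i\<in>UNIV. (?y i)\<^sup>2 * (?G j - (?x i)\<^sup>2))"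
      using eq' by (simp add: raise numeral_2_eq_2 sum_layer_one subperm_singleton sum_diff1)
    also have "\<dots> = 2 * (?G j * ?G l - (\<Sum>i\<in>UNIV. (?x i * ?y i)\<^sup>2))"
      by (simp add: right_diff_distrib sum_subtractf sum_distrib_left power_mult_distrib mult.commute)
    finally have "energy UNIV 2 (subperm f {j, l}) = 2 * (?G j * ?G l - (\<Sum>i\<in>UNIV. (?x i * ?y i)\<^sup>2))" .
    with eq have "?N * (2 * (?G j * ?G l - (\<Sum>i\<in>UNIV. (?x i * ?y i)\<^sup>2))) = 2 * (?N - 1) * ?G j * ?G l"
      by simp
    moreover have "n * z = g * h" if "n * (2 * (g * h - z)) = 2 * (n - 1) * g * h" for n g h z :: real
      using that by (simp add: algebra_simps)
    ultimately show ?thesis by blast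
  qed
  have "?G j * ?G l = (\<Sum>i\<in>UNIV. \<Sum>k\<in>UNIV. (?x i * ?y k) * (?x i * ?y k))"
    by (simp add: sum_product power2_eq_square mult_ac)
  also have "\<dots> = (\<Sum>i\<in>UNIV. \<Sum>k\<in>UNIV. (?x i * ?y i) * (?x k * ?y k))"
    by (intro sum.cong refl) (metis par_cmod mult.assoc mult.commute)
  also have "\<dots> = (\<Sum>i\<in>UNIV. ?x i * ?y i)\<^sup>2"
    by (simp add: sum_product power2_eq_square)
  finally have const: "?x i * ?y i = ?x k * ?y k" for i k
    using norm_sum_sq_eq_imp_constant[of UNIV "\<lambda>i. ?x i * ?y i" i k] sep by simp
  obtain p where p: "?y p \<noteq> 0" using nz by auto
  obtain q where q: "?x q \<noteq> 0" using nz by auto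
  have "?x p * ?y q \<noteq> 0"
    using par_cmod[of q p] p q by (metis mult_eq_0_iff)
  then have nzp: "?x p * ?y p \<noteq> 0" using p by simp
  have same: "?x i = ?x p" for i
  proof -
    have "(?x i)\<^sup>2 * (?x p * ?y p) = (?x i * ?x p) * (?x i * ?y p)"
      by (simp add: power2_eq_square)
    also have "\<dots> = (?x i * ?x p) * (?x p * ?y i)"
      by (simp only: par_cmod[of i p])
    also have "\<dots> = (?x p)\<^sup>2 * (?x i * ?y i)"
      by (simp add: power2_eq_square)
    also have "\<dots> = (?x p)\<^sup>2 * (?x p * ?y p)"
      by (simp only: const[of i p])
    finally have "(?x i)\<^sup>2 = (?x p)\<^sup>2"
      using nzp by (simp only: mult_cancel_right) simp
    then show ?thesis by (simp add: power2_eq_iff_nonneg)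
  qed
  show "?x i = ?x k" by (simp only: same[of i] same[of k])
  show "f j i * f l k = f j k * f l i" by (rule par)
qed

section \<open>The sharp bound and its extremal matrices\<close>

lemma prod_ratio:
  assumes "0 < N"
  shows "(\<Prod>k<N. ratio N k) = (fact N / real N powr (real N / 2))\<^sup>2"
proof -
  have "(\<Prod>k<N. real (N - k)) = (\<Prod>k<N. real (Suc k))"
    by (subst prod.nat_diff_reindex[symmetric]) (auto intro!: prod.cong)
  moreover have "(\<Prod>k<N. real (Suc k)) = fact N"
    by (simp add: fact_prod_Suc atLeast0LessThan)
  moreover have "(real N powr (real N / 2))\<^sup>2 = real N ^ N"
    using assms by (simp add: powr_power powr_realpow)
  ultimately show ?thesis
    unfolding ratio_def prod_dividef prod.distrib by (simp add: power_divide power2_eq_square)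
qed

lemma norm_vec_sq: "(norm (v :: complex ^ 'n))\<^sup>2 = (\<Sum>i\<in>UNIV. (cmod (v $ i))\<^sup>2)"
  by (simp add: norm_vec_def L2_set_def sum_nonneg)

lemma rank_eq_1_iff_outer_product:
  fixes A :: "'a::field ^ 'n ^ 'm"
  shows "rank A = 1 \<longleftrightarrow> A \<noteq> 0 \<and> (\<exists>c u. \<forall>i j. A $ i $ j = c i * u j)"
proof -
  have nz: "vec.dim (rows A) = 0 \<longleftrightarrow> A = 0"
  proof -
    have "rows A \<subseteq> {0} \<longleftrightarrow> (\<forall>i. row i A = 0)" by (auto simp: rows_def)
    then show ?thesis by (simp add: row_def vec_eq_iff)
  qed
  show ?thesis
  proof (intro iffI conjI)
    assume "rank A = 1"
    then have d: "vec.dim (rows A) = 1" by (simp add: row_rank_def_gen)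
    then show "A \<noteq> 0" using nz by auto
    obtain B where "rows A \<subseteq> vec.span B" "card B = 1"
      using vec.basis_exists[of "rows A"] d by metis
    then obtain u where "rows A \<subseteq> vec.span {u}"
      by (metis card_1_singletonE)
    then have "\<forall>i. \<exists>k. row i A = k *s u"
      by (auto simp: rows_def vec.span_singleton)
    then obtain c where "\<And>i. row i A = c i *s u" by metis
    then have "A $ i $ j = c i * u $ j" for i j
      by (metis row_def vec_lambda_beta vec_lambda_eta vector_smult_component)
    then show "\<exists>c u. \<forall>i j. A $ i $ j = c i * u j" by blast
  next
    assume "A \<noteq> 0 \<and> (\<exists>c u. \<forall>i j. A $ i $ j = c i * u j)"
    then obtain c u where "A \<noteq> 0" and A: "\<And>i j. A $ i $ j = c i * u j" by blast
    have "row i A = c i *s (\<chi> j. u j)" for i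
      by (simp add: row_def vec_eq_iff A)
    then have "rows A \<subseteq> vec.span {\<chi> j. u j}"
      by (auto simp: rows_def vec.span_singleton)
    then have "vec.dim (rows A) \<le> 1"
      using vec.dim_le_card[of "rows A" "{\<chi> j. u j}"] by simp
    then show "rank A = 1"
      using nz \<open>A \<noteq> 0\<close> unfolding row_rank_def_gen by linarith
  qed
qed

lemma energy_subperm_eq_permanent:
  fixes F :: "complex ^ 'n ^ 'n"
  shows "energy UNIV CARD('n) (subperm (\<lambda>j i. F $ i $ j) UNIV) = (cmod (permanent F))\<^sup>2"
  by (simp add: energy_def layer_card permanent_eq_subperm)

lemma cmod_permanent_sq_le:
  fixes F :: "complex ^ 'n ^ 'n"
  shows "(cmod (permanent F))\<^sup>2
    \<le> (fact CARD('n) / real CARD('n) powr (real CARD('n) / 2))\<^sup>2 * (\<Prod>j\<in>UNIV. (norm (column j F))\<^sup>2)"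
  using energy_subperm_Un_le[of "UNIV :: 'n set" "{}" "\<lambda>j i. F $ i $ j"]
  by (simp add: energy_subperm_eq_permanent energy_subperm_empty norm_vec_sq column_def
      prod_ratio[symmetric] atLeast0LessThan)

text \<open>
  The columns \<open>j\<close> and \<open>l\<close> are added first.  All factors contributed by the other columns are
  positive, so dividing them out turns equality for the whole matrix into equality for the pair.
\<close>

lemma permanent_extremal_imp_pair_extremal:
  fixes F :: "complex ^ 'n ^ 'n"
  assumes nz: "\<And>j. column j F \<noteq> 0" and "j \<noteq> l"
    and eq: "(cmod (permanent F))\<^sup>2
      = (fact CARD('n) / real CARD('n) powr (real CARD('n) / 2))\<^sup>2 * (\<Prod>j\<in>UNIV. (norm (column j F))\<^sup>2)"
  shows "real CARD('n) * energy UNIV 2 (subperm (\<lambda>j i. F $ i $ j) {j, l})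
      = 2 * (real CARD('n) - 1) * (\<Sum>i\<in>UNIV. (cmod (F $ i $ j))\<^sup>2) * (\<Sum>i\<in>UNIV. (cmod (F $ i $ l))\<^sup>2)"
proof (rule antisym)
  let ?N = "CARD('n)" and ?G = "\<lambda>j. (norm (column j F))\<^sup>2"
  let ?E = "energy UNIV 2 (subperm (\<lambda>j i. F $ i $ j) {j, l})"
  let ?K = "UNIV - {j, l}"
  have G: "?G j = (\<Sum>i\<in>UNIV. (cmod (F $ i $ j))\<^sup>2)" for j
    by (simp add: norm_vec_sq column_def)
  have N: "2 \<le> ?N"
    using card_mono[of UNIV "{j, l}"] \<open>j \<noteq> l\<close> by simp
  then show "real ?N * ?E
      \<le> 2 * (real ?N - 1) * (\<Sum>i\<in>UNIV. (cmod (F $ i $ j))\<^sup>2) * (\<Sum>i\<in>UNIV. (cmod (F $ i $ l))\<^sup>2)"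
    using energy_subperm_pair_le[of j l "\<lambda>j i. F $ i $ j"] \<open>j \<noteq> l\<close> by simp
  define P where "P = (\<Prod>k\<in>{2..<?N}. ratio ?N k)"
  define Q where "Q = (\<Prod>j\<in>?K. ?G j)"
  have "0 < P" unfolding P_def ratio_def by (intro prod_pos) auto
  have "0 < Q" unfolding Q_def by (intro prod_pos) (simp add: nz)
  have card_K: "2 + card ?K = ?N"
    using \<open>j \<noteq> l\<close> N by (simp add: card_Diff_subset)
  have "(\<Prod>k<?N. ratio ?N k) = ratio ?N 0 * ratio ?N 1 * P"
  proof -
    have "{..<?N} = {0, 1} \<union> {2..<?N}" using N by auto
    then have "(\<Prod>k<?N. ratio ?N k) = (\<Prod>k\<in>{0, 1}. ratio ?N k) * P"
      unfolding P_def by (simp only:) (rule prod.union_disjoint, auto)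
    then show ?thesis by simp
  qed
  moreover have "(\<Prod>j\<in>UNIV. ?G j) = ?G j * ?G l * Q"
  proof -
    have "UNIV = {j, l} \<union> ?K" by auto
    then have "(\<Prod>j\<in>UNIV. ?G j) = (\<Prod>j\<in>{j, l}. ?G j) * Q"
      unfolding Q_def by (metis prod.union_disjoint Diff_disjoint finite)
    then show ?thesis using \<open>j \<noteq> l\<close> by simp
  qed
  moreover have "(cmod (permanent F))\<^sup>2 \<le> P * Q * ?E"
  proof -
    have "card {j, l} = 2" "{j, l} \<union> ?K = UNIV" using \<open>j \<noteq> l\<close> by auto
    then show ?thesis
      using energy_subperm_Un_le[of ?K "{j, l}" "\<lambda>j i. F $ i $ j"] card_K
      unfolding P_def Q_def G by (simp only: energy_subperm_eq_permanent) simp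
  qed
  ultimately have "(P * Q) * (ratio ?N 0 * ratio ?N 1 * ?G j * ?G l) \<le> (P * Q) * ?E"
    using eq by (simp add: prod_ratio mult_ac)
  then have "ratio ?N 0 * ratio ?N 1 * ?G j * ?G l \<le> ?E"
    using \<open>0 < P\<close> \<open>0 < Q\<close> by simp
  then show "2 * (real ?N - 1) * (\<Sum>i\<in>UNIV. (cmod (F $ i $ j))\<^sup>2) * (\<Sum>i\<in>UNIV. (cmod (F $ i $ l))\<^sup>2)
      \<le> real ?N * ?E"
    using N by (simp add: ratio_def G[symmetric] field_simps of_nat_diff)
qed

lemma permanent_extremal_imp:
  fixes F :: "complex ^ 'n ^ 'n"
  assumes nz: "\<And>j. column j F \<noteq> 0" and N: "2 < CARD('n)"
    and eq: "(cmod (permanent F))\<^sup>2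
      = (fact CARD('n) / real CARD('n) powr (real CARD('n) / 2))\<^sup>2 * (\<Prod>j\<in>UNIV. (norm (column j F))\<^sup>2)"
  shows "rank F = 1" and "constant_modulus (column j F)"
proof -
  have nz': "\<exists>i. F $ i $ j \<noteq> 0" for j
    using nz[of j] by (auto simp: column_def vec_eq_iff)
  note pair = energy_subperm_pair_eq_imp[OF _ N _ _ permanent_extremal_imp_pair_extremal[OF nz _ eq]]
  (* Vanishing of all 2 x 2 minors makes every row a multiple of the row of a nonzero entry. *)
  have minors: "F $ i $ j * F $ k $ l = F $ k $ j * F $ i $ l" for i j k l
    using pair(1)[of j l i k] nz' by (cases "j = l") auto
  obtain i0 j0 where "F $ i0 $ j0 \<noteq> 0" using nz' by blast
  then have "F $ i $ j = F $ i $ j0 / F $ i0 $ j0 * F $ i0 $ j" for i j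
    using minors[of i j i0 j0] by (simp add: field_simps)
  then have "\<exists>c u. \<forall>i j. F $ i $ j = c i * u j"
    by (intro exI[of _ "\<lambda>i. F $ i $ j0 / F $ i0 $ j0"] exI[of _ "\<lambda>j. F $ i0 $ j"] allI)
  moreover have "F \<noteq> 0" using \<open>F $ i0 $ j0 \<noteq> 0\<close> by auto
  ultimately show "rank F = 1"
    unfolding rank_eq_1_iff_outer_product by blast
  have "\<exists>l. l \<noteq> j"
  proof (rule ccontr)
    assume "\<nexists>l. l \<noteq> j"
    then have "UNIV = {j}" by auto
    then have "CARD('n) = card {j}" by metis
    then show False using N by simp
  qed
  then obtain l where "j \<noteq> l" by metis
  then show "constant_modulus (column j F)"
    using pair(2)[of j l] nz' by (auto simp: constant_modulus_def column_def)
qed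

text \<open>
  Every permutation contributes the same product, because permuting the factors \<open>c i\<close> does not
  change their product.
\<close>

lemma permanent_outer_product:
  fixes A :: "'a::comm_semiring_1 ^ 'n ^ 'n"
  assumes "\<And>i j. A $ i $ j = c i * u j"
  shows "permanent A = of_nat (fact CARD('n)) * (\<Prod>j\<in>UNIV. A $ j $ j)"
proof -
  have "(\<Prod>j\<in>UNIV. A $ \<sigma> j $ j) = (\<Prod>j\<in>UNIV. A $ j $ j)" if "\<sigma> permutes UNIV" for \<sigma>
    using prod.permute[OF that, of c] by (simp add: assms prod.distrib o_def)
  then have "permanent A = (\<Sum>\<sigma> | \<sigma> permutes (UNIV :: 'n set). \<Prod>j\<in>UNIV. A $ j $ j)"
    unfolding permanent_def by (intro sum.cong) auto
  then show ?thesis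
    by (simp add: card_permutations)
qed

lemma norm_constant_modulus:
  fixes v :: "complex ^ 'n"
  assumes "constant_modulus v"
  shows "norm v = sqrt (real CARD('n)) * cmod (v $ i)"
proof -
  have "(norm v)\<^sup>2 = (\<Sum>k\<in>(UNIV :: 'n set). (cmod (v $ i))\<^sup>2)"
    unfolding norm_vec_sq using assms by (intro sum.cong refl) (metis constant_modulus_def)
  also have "\<dots> = (sqrt (real CARD('n)) * cmod (v $ i))\<^sup>2"
    by (simp add: power_mult_distrib)
  finally show ?thesis
    by (simp add: power2_eq_iff_nonneg)
qed

lemma permanent_rank_1_constant_modulus:
  fixes F :: "complex ^ 'n ^ 'n"
  assumes "rank F = 1" and const: "\<And>j. constant_modulus (column j F)"
  shows "cmod (permanent F)
    = fact CARD('n) / real CARD('n) powr (real CARD('n) / 2) * (\<Prod>j\<in>UNIV. norm (column j F))"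
proof -
  obtain c u where "\<And>i j. F $ i $ j = c i * u j"
    using \<open>rank F = 1\<close> unfolding rank_eq_1_iff_outer_product by blast
  then have "cmod (permanent F) = fact CARD('n) * (\<Prod>j\<in>UNIV. cmod (F $ j $ j))"
    by (subst permanent_outer_product) (auto simp: norm_mult prod_norm[symmetric])
  moreover have "(\<Prod>j\<in>UNIV. norm (column j F))
      = real CARD('n) powr (real CARD('n) / 2) * (\<Prod>j\<in>UNIV. cmod (F $ j $ j))"
  proof -
    have "norm (column j F) = sqrt (real CARD('n)) * cmod (F $ j $ j)" for j
      using norm_constant_modulus[OF const, of j j] by (simp add: column_def)
    moreover have "sqrt (real CARD('n)) ^ CARD('n) = real CARD('n) powr (real CARD('n) / 2)"
      by (simp add: powr_half_sqrt[symmetric] powr_power)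
    ultimately show ?thesis by (simp add: prod.distrib)
  qed
  ultimately show ?thesis by simp
qed

theorem theorem1p1:
  fixes f :: "'n::finite \<Rightarrow> complex ^ 'n" and F :: "complex ^ 'n ^ 'n"
  assumes "\<And>j. column j F = f j"
  shows "cmod (permanent F)
           \<le> fact CARD('n) / real CARD('n) powr (real CARD('n) / 2) * (\<Prod>j\<in>UNIV. norm (f j))
       \<and> (CARD('n) > 2 \<longrightarrow>
           (cmod (permanent F)
              = fact CARD('n) / real CARD('n) powr (real CARD('n) / 2) * (\<Prod>j\<in>UNIV. norm (f j))
            \<longleftrightarrow> (\<exists>j. f j = 0) \<or> (rank F = 1 \<and> (\<forall>j. constant_modulus (f j)))))"
    (is "?p \<le> ?b \<and> (_ \<longrightarrow> (_ \<longleftrightarrow> ?zero \<or> ?ext))")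
proof -
  have b2: "?b\<^sup>2 = (fact CARD('n) / real CARD('n) powr (real CARD('n) / 2))\<^sup>2
      * (\<Prod>j\<in>UNIV. (norm (column j F))\<^sup>2)"
    by (simp add: assms power_mult_distrib power_divide prod_power_distrib)
  have "0 \<le> ?b" by (intro mult_nonneg_nonneg prod_nonneg) auto
  then have le: "?p \<le> ?b"
    using cmod_permanent_sq_le[of F] unfolding b2[symmetric] by (rule power2_le_imp_le[rotated])
  have "?p = ?b" if "f j = 0" for j
  proof -
    have "(\<Prod>j\<in>UNIV. norm (f j)) = 0"
      using that by (intro prod_zero) auto
    then have "?b = 0" by simp
    then show ?thesis using le by (metis antisym norm_ge_zero)
  qed
  moreover have "?p = ?b" if ?ext
    using permanent_rank_1_constant_modulus[of F] that by (simp add: assms)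
  moreover have ?ext if "?p = ?b" "\<not> ?zero" "2 < CARD('n)"
  proof -
    have "?p\<^sup>2 = ?b\<^sup>2" using that(1) by simp
    note eq = this[unfolded b2]
    show ?thesis
      using permanent_extremal_imp[OF _ that(3) eq] that(2) by (simp add: assms)
  qed
  ultimately show ?thesis using le by blast
qed

end
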